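(* Let $p\ge 1$, let $H\in\mathbb{R}^{p\times p}$ be symmetric positive semidefinite with $H_{ii}=1$ for all $i$, let $a\in\mathbb{R}^p$, $r_i>0$ for $i=1,\dots,p$, and let $f(x)=\tfrac12 x^\top Hx-a^\top x$ on the box $\mathcal{B}=\prod_{i=1}^p[0,r_i]$, with solution set $X_*$, objective gap $\Delta$, cyclic sweep map $\mathcal{C}$, and strictly lower triangular part $T$ of $H$ as defined in the context. Suppose $M\in\mathbb{R}^{p\times p}$ is a symmetric positive semidefinite matrix such that, for every $x\in\mathcal{B}$, with $\bar x=\Pi_{X_*}(x)$ the Euclidean projection of $x$ onto $X_*$, $$\Delta(x)\ \ge\ \tfrac12 (x-\bar x)^\top M(x-\bar x),$$ and suppose $H+M\succ0$. For $0<\theta<1$ set $$A_\theta(M):=\frac{\lambda_{\max}\!\left(T(H+\theta M)^{-1}T^\top\right)}{1-\theta}.$$ Then, for every $\theta\in(0,1)$, $H+\theta M\succ0$ and, for every $x\in\mathcal{B}$, $$\Delta(\mathcal{C}(x))\le\tfrac12 A_\theta(M)\,\|\mathcal{C}(x)-x\|^2 \qquad\text{and}\qquad \Delta(\mathcal{C}(x))\le\frac{A_\theta(M)}{1+A_\theta(M)}\,\Delta(x).$$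
   Context: Norms are Euclidean; $S\succeq0$ (resp. $S\succ0$) means $S$ is positive semidefinite (resp. positive definite); $\lambda_{\max}$ is the largest eigenvalue of a symmetric matrix. $X_*=\arg\min_{x\in\mathcal{B}}f(x)$ (nonempty, compact, convex), $f_*=\min_{x\in\mathcal{B}}f(x)$, $\Delta(x)=f(x)-f_*$, and $g(x)=Hx-a$ is the gradient of $f$. Cyclic sweep: given $x\in\mathcal{B}$, put $x^0=x$; for $i=1,\dots,p$, $x^i$ agrees with $x^{i-1}$ except in coordinate $i$, where $x^i_i=\min\{r_i,\max\{0,\,x^{i-1}_i-g_i(x^{i-1})\}\}$ (the exact minimizer of $f$ in coordinate $i$ over $[0,r_i]$, since $H_{ii}=1$). Then $\mathcal{C}(x):=x^p$. $T$ is the strictly lower triangular part of $H$: $T_{ij}=H_{ij}$ for $i>j$ and $T_{ij}=0$ for $i\le j$, so $H=I+T+T^\top$. *)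

theory Defs
  imports "HOL-Analysis.Analysis"
begin

text \<open>The coordinates $1, \dots, p$ are the elements of a finite linearly ordered type; the order
  is the one in which a sweep visits the coordinates, and it determines the strictly lower
  triangular part of a matrix. The box is \<^term>\<open>cbox 0 r\<close>.\<close>

definition pos_semidef :: "real^'n^'n \<Rightarrow> bool" where
  "pos_semidef S \<longleftrightarrow> transpose S = S \<and> (\<forall>x. x \<bullet> (S *v x) \<ge> 0)"

definition pos_def :: "real^'n^'n \<Rightarrow> bool" where
  "pos_def S \<longleftrightarrow> transpose S = S \<and> (\<forall>x. x \<noteq> 0 \<longrightarrow> x \<bullet> (S *v x) > 0)"

definition real_eigenvalue :: "real^'n^'n \<Rightarrow> real \<Rightarrow> bool" where
  "real_eigenvalue S l \<longleftrightarrow> (\<exists>v. v \<noteq> 0 \<and> S *v v = l *\<^sub>R v)"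

definition lambda_max :: "real^'n^'n \<Rightarrow> real" where
  "lambda_max S = (GREATEST l. real_eigenvalue S l)"

definition quad_obj :: "real^'n^'n \<Rightarrow> real^'n \<Rightarrow> real^'n \<Rightarrow> real" where
  "quad_obj H a x = 1/2 * (x \<bullet> (H *v x)) - a \<bullet> x"

definition quad_grad :: "real^'n^'n \<Rightarrow> real^'n \<Rightarrow> real^'n \<Rightarrow> real^'n" where
  "quad_grad H a x = H *v x - a"

definition sol_set :: "real^'n^'n \<Rightarrow> real^'n \<Rightarrow> real^'n \<Rightarrow> (real^'n) set" where
  "sol_set H a r = {x. is_arg_min (quad_obj H a) (\<lambda>y. y \<in> cbox 0 r) x}"

text \<open>The infimum below is attained as soon as the box is nonempty, see
  \<open>min_val_attained\<close>.\<close>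

definition min_val :: "real^'n^'n \<Rightarrow> real^'n \<Rightarrow> real^'n \<Rightarrow> real" where
  "min_val H a r = (INF x\<in>cbox 0 r. quad_obj H a x)"

definition obj_gap :: "real^'n^'n \<Rightarrow> real^'n \<Rightarrow> real^'n \<Rightarrow> real^'n \<Rightarrow> real" where
  "obj_gap H a r x = quad_obj H a x - min_val H a r"

definition coord_step ::
  "real^'n^'n \<Rightarrow> real^'n \<Rightarrow> real^'n \<Rightarrow> 'n \<Rightarrow> real^'n \<Rightarrow> real^'n" where
  "coord_step H a r i x =
     (\<chi> j. if j = i then min (r $ i) (max 0 (x $ i - quad_grad H a x $ i)) else x $ j)"

definition cyclic_sweep ::
  "real^'n::{finite,linorder}^'n::{finite,linorder} \<Rightarrow> real^'n::{finite,linorder} \<Rightarrow> real^'n::{finite,linorder} \<Rightarrow>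
     real^'n::{finite,linorder} \<Rightarrow> real^'n::{finite,linorder}" where
  "cyclic_sweep H a r = fold (coord_step H a r) (sorted_list_of_set UNIV)"

definition strict_lower ::
  "real^'n::{finite,linorder}^'n::{finite,linorder} \<Rightarrow> real^'n::{finite,linorder}^'n::{finite,linorder}" where
  "strict_lower H = (\<chi> i j. if i > j then H $ i $ j else 0)"

definition A_const ::
  "real^'n::{finite,linorder}^'n::{finite,linorder} \<Rightarrow>
     real^'n::{finite,linorder}^'n::{finite,linorder} \<Rightarrow> real \<Rightarrow> real" where
  "A_const H M \<theta> =
     lambda_max (strict_lower H ** matrix_inv (H + \<theta> *\<^sub>R M) ** transpose (strict_lower H))
       / (1 - \<theta>)"

lemma min_val_attained:
  fixes H :: "real^'n^'n"
  assumes "\<forall>i. r $ i \<ge> 0"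
  shows "\<exists>x. x \<in> sol_set H a r"
    and "x \<in> sol_set H a r \<Longrightarrow> min_val H a r = quad_obj H a x"
proof -
  have "continuous_on (cbox 0 r) (quad_obj H a)"
    unfolding quad_obj_def
    by (intro continuous_intros matrix_vector_mult_linear_continuous_on)
  moreover have "0 \<in> cbox 0 r"
    using assms by (simp add: mem_box_cart)
  ultimately have "\<exists>x\<in>cbox 0 r. \<forall>y\<in>cbox 0 r. quad_obj H a x \<le> quad_obj H a y"
    by (intro continuous_attains_inf) auto
  then show "\<exists>x. x \<in> sol_set H a r"
    by (auto simp: sol_set_def is_arg_min_linorder)
next
  assume "x \<in> sol_set H a r"
  then show "min_val H a r = quad_obj H a x"
    unfolding min_val_def sol_set_def is_arg_min_linorder
    by (intro cInf_eq_minimum) auto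
qed

end

theory Submission
  imports Defs
begin

text \<open>Write $y = \mathcal{C}(x)$, $d = y - x$, and let $g$ be the gradient. Coordinate $i$ is updated
  when the coordinates $j > i$ still have their old values, so the coordinatewise optimality conditions of
  the sweep add up to the variational inequality $(g(y) - T^\top d) \cdot (z - y) \ge 0$ for
  all $z$ in the box. Taking $z = x$ yields the descent
  $\Delta(x) - \Delta(y) \ge \frac12 \|d\|^2$. Taking for $z$ the projection of $y$ onto the
  solution set yields, with $e = y - z$, the bound
  $\Delta(y) \le e \cdot T^\top d - \frac12 e \cdot H e$; subtracting $\theta$ times the growth
  condition and completing the square in the metric $H + \theta M$ gives the first claim, and the
  second one follows by combining it with the descent.\<close>

section \<open>Quadratic forms and the largest eigenvalue\<close>

lemma symmetric_inner_matrix: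
  fixes S :: "real^'n^'n"
  assumes "transpose S = S"
  shows "x \<bullet> (S *v y) = y \<bullet> (S *v x)"
  by (metis assms dot_lmul_matrix inner_commute transpose_matrix_vector)

lemma matrix_vector_mult_uminus: "(S :: real^'n^'m) *v (- x) = - (S *v x)"
  using matrix_vector_mult_scaleR[of S "-1" x] by simp

lemma symmetric_quadratic_add:
  fixes S :: "real^'n^'n"
  assumes "transpose S = S"
  shows "(x + y) \<bullet> (S *v (x + y)) = x \<bullet> (S *v x) + 2 * (y \<bullet> (S *v x)) + y \<bullet> (S *v y)"
  using symmetric_inner_matrix[OF assms, of x y]
  by (simp add: matrix_vector_right_distrib inner_simps)

text \<open>If \<open>S *v v\<close> were nonzero, a short step from \<open>v\<close> along
  \<open>- (S *v v)\<close> would make the form negative: the form vanishes at \<open>v\<close>, and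
  the first-order decrease beats the quadratic term.\<close>

lemma psd_kernel:
  fixes S :: "real^'n^'n"
  assumes "pos_semidef S" and v: "v \<bullet> (S *v v) = 0"
  shows "S *v v = 0"
proof (rule ccontr)
  assume nz: "S *v v \<noteq> 0"
  define w where "w = S *v v"
  define q where "q = w \<bullet> (S *v w)"
  have sym: "transpose S = S" and nn: "x \<bullet> (S *v x) \<ge> 0" for x
    using assms by (auto simp: pos_semidef_def)
  have pos: "w \<bullet> w > 0" using nz by (simp add: w_def)
  have q: "q \<ge> 0" using nn by (simp add: q_def)
  \<comment> \<open>The \<open>+ 1\<close> keeps the denominator positive when \<open>q = 0\<close>;
    it also gives \<open>t * q + t = w \<bullet> w\<close>, so \<open>t * q\<close> stays below
    \<open>w \<bullet> w\<close>, which contradicts nonnegativity of the form.\<close>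
  define t where "t = (w \<bullet> w) / (q + 1)"
  have t: "t > 0" using pos q by (simp add: t_def)
  have "0 \<le> (v + - (t *\<^sub>R w)) \<bullet> (S *v (v + - (t *\<^sub>R w)))" by (rule nn)
  also have "\<dots> = t * (t * q - 2 * (w \<bullet> w))"
    unfolding symmetric_quadratic_add[OF sym] v q_def
    by (simp add: matrix_vector_mult_scaleR matrix_vector_mult_uminus w_def[symmetric] right_diff_distrib)
  finally have "t * q \<ge> 2 * (w \<bullet> w)" using t by (simp add: zero_le_mult_iff)
  moreover have "t * (q + 1) = w \<bullet> w" using q by (simp add: t_def)
  then have "t * q + t = w \<bullet> w" by (simp add: distrib_left)
  ultimately show False using t pos by linarith
qed

text \<open>By compactness the form attains its maximum \<open>l\<close> on the unit sphere at some
  \<open>v\<close>. Then \<open>l *\<^sub>R mat 1 - S\<close> is positive semidefinite with form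
  zero at \<open>v\<close>, so \<open>psd_kernel\<close> makes \<open>v\<close> an eigenvector.
  Hence the \<open>GREATEST\<close> in \<open>lambda_max\<close> is attained, and it equals
  \<open>l\<close>.\<close>

lemma lambda_max_bounds:
  fixes S :: "real^'n^'n"
  assumes sym: "transpose S = S"
  shows "real_eigenvalue S (lambda_max S)"
    and "x \<bullet> (S *v x) \<le> lambda_max S * (norm x)\<^sup>2"
proof -
  have "continuous_on (sphere 0 1) (\<lambda>x. x \<bullet> (S *v x))"
    by (intro continuous_intros matrix_vector_mult_linear_continuous_on)
  moreover have "sphere (0::real^'n) 1 \<noteq> {}" by simp
  ultimately obtain v where v: "norm v = 1"
    and max: "\<And>x. norm x = 1 \<Longrightarrow> x \<bullet> (S *v x) \<le> v \<bullet> (S *v v)"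
    using continuous_attains_sup[of "sphere (0::real^'n) 1" "\<lambda>x. x \<bullet> (S *v x)"] by auto
  define l where "l = v \<bullet> (S *v v)"
  have le: "x \<bullet> (S *v x) \<le> l * (norm x)\<^sup>2" for x
  proof (cases "x = 0")
    case False
    have "(x /\<^sub>R norm x) \<bullet> (S *v (x /\<^sub>R norm x)) \<le> l"
      unfolding l_def by (rule max) (use False in simp)
    then show ?thesis using False
      by (simp add: matrix_vector_mult_scaleR field_simps power2_eq_square)
  qed simp
  have mv: "(l *\<^sub>R mat 1 - S) *v x = l *\<^sub>R x - S *v x" for x
    by (simp add: matrix_vector_mult_diff_rdistrib scaleR_matrix_vector_assoc[symmetric])
  have "transpose (l *\<^sub>R mat 1 - S) = l *\<^sub>R mat 1 - S"
    using sym by (auto simp: transpose_def vec_eq_iff mat_def)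
  then have "pos_semidef (l *\<^sub>R mat 1 - S)"
    using le by (simp add: pos_semidef_def mv inner_diff_right dot_square_norm)
  moreover have "v \<bullet> ((l *\<^sub>R mat 1 - S) *v v) = 0"
    unfolding mv by (simp add: inner_diff_right dot_square_norm v l_def)
  ultimately have "(l *\<^sub>R mat 1 - S) *v v = 0" by (rule psd_kernel)
  then have ev: "real_eigenvalue S l"
    unfolding real_eigenvalue_def mv using v by (intro exI[of _ v]) auto
  have "k \<le> l" if k: "real_eigenvalue S k" for k
  proof -
    obtain u where u: "u \<noteq> 0" "S *v u = k *\<^sub>R u"
      using k by (auto simp: real_eigenvalue_def)
    then show ?thesis using le[of u] by (simp add: dot_square_norm)
  qed
  then have l: "lambda_max S = l"
    unfolding lambda_max_def using ev by (intro Greatest_equality)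
  show "real_eigenvalue S (lambda_max S)" using ev l by simp
  show "x \<bullet> (S *v x) \<le> lambda_max S * (norm x)\<^sup>2" using le l by simp
qed

lemma lambda_max_nonneg:
  assumes "pos_semidef S"
  shows "lambda_max S \<ge> 0"
proof -
  obtain v where v: "v \<noteq> 0" "S *v v = lambda_max S *\<^sub>R v"
    using lambda_max_bounds(1) assms by (auto simp: pos_semidef_def real_eigenvalue_def)
  have "0 \<le> v \<bullet> (S *v v)"
    using assms by (simp add: pos_semidef_def)
  then show ?thesis using v by (simp add: dot_square_norm zero_le_mult_iff)
qed

lemma pos_def_add_scaleR:
  fixes H M :: "real^'n^'n"
  assumes "pos_semidef H" "pos_semidef M" "pos_def (H + M)" "0 < \<theta>"
  shows "pos_def (H + \<theta> *\<^sub>R M)"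
  unfolding pos_def_def
proof (intro conjI allI impI)
  show "transpose (H + \<theta> *\<^sub>R M) = H + \<theta> *\<^sub>R M"
    using assms by (auto simp: pos_semidef_def transpose_def vec_eq_iff)
  fix x :: "real^'n" assume "x \<noteq> 0"
  then have "x \<bullet> (H *v x) + x \<bullet> (M *v x) > 0" "x \<bullet> (H *v x) \<ge> 0" "x \<bullet> (M *v x) \<ge> 0"
    using assms
    by (auto simp: pos_semidef_def pos_def_def matrix_vector_mult_add_rdistrib inner_add_right)
  \<comment> \<open>If the form of M vanishes at x, that of H is positive; otherwise the scaled form
    of M is already positive.\<close>
  then have "x \<bullet> (H *v x) + \<theta> * (x \<bullet> (M *v x)) > 0"
    using \<open>0 < \<theta>\<close> by (cases "x \<bullet> (M *v x) = 0") (auto intro: add_nonneg_pos)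
  then show "x \<bullet> ((H + \<theta> *\<^sub>R M) *v x) > 0"
    by (simp add: matrix_vector_mult_add_rdistrib inner_add_right
        scaleR_matrix_vector_assoc[symmetric])
qed

lemma pos_def_imp_psd: "pos_def K \<Longrightarrow> pos_semidef K"
  by (metis inner_zero_left less_eq_real_def pos_def_def pos_semidef_def)

lemma pos_def_inverse:
  fixes K :: "real^'n^'n"
  assumes "pos_def K"
  shows "K ** matrix_inv K = mat 1" and "pos_semidef (matrix_inv K)"
proof -
  let ?L = "matrix_inv K"
  have "\<forall>x. K *v x = 0 \<longrightarrow> x = 0"
    using assms by (metis inner_zero_right less_irrefl pos_def_def)
  then have inv: "invertible K"
    using invertible_left_inverse matrix_left_invertible_ker by blast
  then show KL: "K ** ?L = mat 1"
    unfolding invertible_def matrix_inv_def by (rule someI2_ex) simp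
  \<comment> \<open>Transposing \<open>K ** ?L = mat 1\<close> makes \<open>transpose ?L\<close> a
    left inverse of K; it therefore coincides with the right inverse \<open>?L\<close>.\<close>
  have "transpose ?L ** K = mat 1"
    using KL assms by (metis matrix_transpose_mul pos_def_def transpose_mat)
  then have sym: "transpose ?L = ?L"
    by (metis KL matrix_mul_assoc matrix_mul_lid matrix_mul_rid)
  moreover have "x \<bullet> (?L *v x) \<ge> 0" for x
  proof -
    have "K *v (?L *v x) = x" by (simp add: KL matrix_vector_mul_assoc)
    then show ?thesis
      using pos_def_imp_psd[OF assms] by (metis inner_commute pos_semidef_def)
  qed
  ultimately show "pos_semidef ?L" by (simp add: pos_semidef_def)
qed

lemma psd_congruence:
  fixes T L :: "real^'n^'n"
  assumes "pos_semidef L"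
  shows "pos_semidef (T ** L ** transpose T)"
proof -
  have "x \<bullet> ((T ** L ** transpose T) *v x) = (transpose T *v x) \<bullet> (L *v (transpose T *v x))" for x
    by (metis dot_lmul_matrix matrix_vector_mul_assoc transpose_matrix_vector)
  then show ?thesis
    using assms by (simp add: pos_semidef_def matrix_transpose_mul matrix_mul_assoc)
qed

text \<open>Completing the square: the difference of the two sides is half the form of K at
  \<open>u - e\<close>, where \<open>u = matrix_inv K *v b\<close> maximizes the left side over
  \<open>e\<close>.\<close>

lemma inner_minus_half_quadratic_le:
  fixes K :: "real^'n^'n"
  assumes "pos_def K"
  shows "e \<bullet> b - 1/2 * (e \<bullet> (K *v e)) \<le> 1/2 * (b \<bullet> (matrix_inv K *v b))"
proof -
  define u where "u = matrix_inv K *v b"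
  have sym: "transpose K = K" and nn: "x \<bullet> (K *v x) \<ge> 0" for x
    using pos_def_imp_psd[OF assms] by (auto simp: pos_semidef_def)
  have b: "K *v u = b"
    by (simp add: u_def matrix_vector_mul_assoc pos_def_inverse[OF assms])
  have "0 \<le> (u + - e) \<bullet> (K *v (u + - e))" by (rule nn)
  also have "\<dots> = u \<bullet> b - 2 * (e \<bullet> b) + e \<bullet> (K *v e)"
    unfolding symmetric_quadratic_add[OF sym] b
    by (simp add: matrix_vector_mult_uminus)
  finally show ?thesis by (simp add: u_def inner_commute)
qed

section \<open>The solution set\<close>

lemma sol_set_subset_box: "sol_set H a r \<subseteq> cbox 0 r"
  by (auto simp: sol_set_def is_arg_min_linorder)

text \<open>\<open>closest_point\<close> is a choice operator, so membership requires a nonempty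
  closed set. Closedness comes from writing the solution set as a sublevel set of a continuous
  function on the box.\<close>

lemma closest_point_in_sol_set:
  assumes "\<forall>i. r $ i \<ge> 0"
  shows "closest_point (sol_set H a r) x \<in> sol_set H a r"
proof -
  obtain s where s: "s \<in> sol_set H a r" using min_val_attained(1)[OF assms] by blast
  have "sol_set H a r = {y \<in> cbox 0 r. quad_obj H a y \<le> quad_obj H a s}"
    using s by (force simp: sol_set_def is_arg_min_linorder)
  moreover have "continuous_on (cbox 0 r) (quad_obj H a)"
    unfolding quad_obj_def
    by (intro continuous_intros matrix_vector_mult_linear_continuous_on)
  ultimately have "closed (sol_set H a r)"
    by (auto intro: continuous_closed_preimage_constant continuous_on_closed_Collect_le)
  then show ?thesis using s by (intro closest_point_in_set) auto
qed

lemma quad_obj_expand: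
  fixes H :: "real^'n^'n"
  assumes "transpose H = H"
  shows "quad_obj H a z =
    quad_obj H a y + quad_grad H a y \<bullet> (z - y) + 1/2 * ((z - y) \<bullet> (H *v (z - y)))"
  using symmetric_quadratic_add[OF assms, of y "z - y"]
  by (simp add: quad_obj_def quad_grad_def inner_diff_left inner_diff_right inner_commute)

section \<open>The cyclic sweep\<close>

lemma fold_coord_step_notin:
  "j \<notin> set is \<Longrightarrow> fold (coord_step H a r) is x $ j = x $ j"
  by (induction "is" arbitrary: x) (auto simp: coord_step_def)

text \<open>Each coordinate is visited exactly once, in increasing order. When \<open>i\<close> is
  reached, the smaller coordinates are final and the others untouched, so the current iterate is
  \<open>w i\<close>, and later steps leave coordinate \<open>i\<close> alone.\<close>

lemma cyclic_sweep_nth: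
  fixes H :: "real^'n::{finite,linorder}^'n::{finite,linorder}"
    and a r x :: "real^'n::{finite,linorder}"
  defines "y \<equiv> cyclic_sweep H a r x"
  defines "w i \<equiv> (\<chi> j. if j < i then y $ j else x $ j)"
  shows "y $ i = min (r $ i) (max 0 (x $ i - quad_grad H a (w i) $ i))"
proof -
  define l where "l = sorted_list_of_set (UNIV :: 'n set)"
  have "i \<in> set l" by (simp add: l_def)
  then obtain us vs where l: "l = us @ i # vs" by (meson split_list)
  have "sorted_wrt (<) (us @ i # vs)"
    using l by (metis l_def strict_sorted_list_of_set)
  then have lt: "\<And>j. j \<in> set us \<Longrightarrow> j < i" "\<And>j. j \<in> set vs \<Longrightarrow> i < j"
    by (auto simp: sorted_wrt_append)
  have "set us \<union> {i} \<union> set vs = UNIV"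
    using l by (metis Un_insert_right finite_class.finite_UNIV l_def list.simps(15) set_append
        set_sorted_list_of_set sup_bot_right Un_insert_left Un_empty_right)
  then have us: "j \<in> set us \<longleftrightarrow> j < i" for j
    using lt by (metis UNIV_I UnE less_asym less_irrefl singletonD)
  define v where "v = fold (coord_step H a r) us x"
  have y: "y = fold (coord_step H a r) vs (coord_step H a r i v)"
    by (simp add: y_def cyclic_sweep_def l_def[symmetric] l v_def)
  have "v $ j = w i $ j" for j
  proof (cases "j < i")
    case True
    then have "j \<notin> set vs" "j \<noteq> i" using lt(2) by force+
    then show ?thesis
      using True by (simp add: w_def y fold_coord_step_notin) (simp add: coord_step_def)
  next
    case False
    then show ?thesis using us by (simp add: w_def v_def fold_coord_step_notin)
  qed
  then have "v = w i" by (simp add: vec_eq_iff)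
  moreover have "y $ i = coord_step H a r i v $ i"
    using lt(2) unfolding y by (intro fold_coord_step_notin) blast
  ultimately show ?thesis by (simp add: coord_step_def w_def)
qed

lemma cyclic_sweep_in_box:
  assumes "\<forall>i. r $ i \<ge> 0"
  shows "cyclic_sweep H a r x \<in> cbox 0 r"
  using assms by (auto simp: mem_box_cart cyclic_sweep_nth[of H a r x])

lemma cyclic_sweep_variational:
  fixes H :: "real^'n::{finite,linorder}^'n::{finite,linorder}"
    and a r x z :: "real^'n::{finite,linorder}"
  assumes diag: "\<forall>i. H $ i $ i = 1" and sym: "transpose H = H" and z: "z \<in> cbox 0 r"
  defines "y \<equiv> cyclic_sweep H a r x"
  shows "(transpose (strict_lower H) *v (y - x)) \<bullet> (z - y) \<le> quad_grad H a y \<bullet> (z - y)"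
proof -
  let ?T = "strict_lower H"
  have "(transpose ?T *v (y - x)) $ i * (z $ i - y $ i) \<le> quad_grad H a y $ i * (z $ i - y $ i)"
    for i
  proof -
    define w where "w = (\<chi> j. if j < i then y $ j else x $ j)"
    \<comment> \<open>Passing from \<open>w\<close> to \<open>y\<close> changes only coordinates
      \<open>j >= i\<close>: those above \<open>i\<close> give row \<open>i\<close> of the
      transposed strictly lower part, and \<open>j = i\<close> gives the last term because the
      diagonal is 1.\<close>
    have "H $ i $ j * y $ j =
        H $ i $ j * w $ j + transpose ?T $ i $ j * (y $ j - x $ j)
          + (if j = i then y $ i - x $ i else 0)" for j
    proof -
      have "H $ j $ i = H $ i $ j" using sym by (metis transpose_def vec_lambda_beta)
      then show ?thesis
        using diag by (auto simp: w_def strict_lower_def transpose_def algebra_simps)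
    qed
    then have Hy: "(H *v y) $ i = (H *v w) $ i + (transpose ?T *v (y - x)) $ i + (y $ i - x $ i)"
      by (simp add: matrix_vector_mult_def sum.distrib)
    have yi: "y $ i = min (r $ i) (max 0 (x $ i - quad_grad H a w $ i))"
      unfolding y_def w_def by (rule cyclic_sweep_nth)
    have zi: "0 \<le> z $ i" "z $ i \<le> r $ i" using z by (auto simp: mem_box_cart)
    \<comment> \<open>This is the one-dimensional projection inequality: \<open>y $ i\<close> is the
      projection of \<open>x $ i - quad_grad H a w $ i\<close> onto the interval from 0 to
      \<open>r $ i\<close>, which contains \<open>z $ i\<close>.\<close>
    have "0 \<le> (y $ i - (x $ i - quad_grad H a w $ i)) * (z $ i - y $ i)"
      using yi zi by (auto simp: min_def max_def zero_le_mult_iff split: if_splits)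
    also have "y $ i - (x $ i - quad_grad H a w $ i)
        = quad_grad H a y $ i - (transpose ?T *v (y - x)) $ i"
      by (simp add: quad_grad_def Hy)
    finally show ?thesis by (simp add: algebra_simps)
  qed
  then show ?thesis by (auto simp: inner_vec_def intro: sum_mono)
qed

lemma quadratic_strict_lower:
  fixes H :: "real^'n::{finite,linorder}^'n::{finite,linorder}"
  assumes diag: "\<forall>i. H $ i $ i = 1" and sym: "transpose H = H"
  shows "d \<bullet> (H *v d) = (norm d)\<^sup>2 + 2 * (d \<bullet> (transpose (strict_lower H) *v d))"
proof -
  let ?T = "strict_lower H"
  have "H $ i $ j = (mat 1 + ?T + transpose ?T) $ i $ j" for i j
  proof -
    have "H $ j $ i = H $ i $ j" using sym by (metis transpose_def vec_lambda_beta)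
    then show ?thesis
      using diag by (cases i j rule: linorder_cases) (auto simp: mat_def strict_lower_def transpose_def)
  qed
  then have "H = mat 1 + ?T + transpose ?T" by (simp only: vec_eq_iff) blast
  then have "H *v d = (mat 1 + ?T + transpose ?T) *v d" by (rule arg_cong)
  then have "H *v d = d + ?T *v d + transpose ?T *v d"
    by (simp only: matrix_vector_mul_lid matrix_vector_mult_add_rdistrib)
  moreover have "d \<bullet> (?T *v d) = d \<bullet> (transpose ?T *v d)"
    by (metis dot_lmul_matrix inner_commute transpose_matrix_vector)
  ultimately show ?thesis by (simp add: inner_add_right dot_square_norm)
qed

text \<open>Test the variational inequality with the starting point and expand the objective around
  \<open>y\<close>. By \<open>quadratic_strict_lower\<close>, the triangular term in half the form
  of H at \<open>d\<close> cancels the bound on the gradient term, leaving half the squared step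
  length.\<close>

lemma cyclic_sweep_descent:
  fixes H :: "real^'n::{finite,linorder}^'n::{finite,linorder}"
  assumes "\<forall>i. H $ i $ i = 1" "transpose H = H" "x \<in> cbox 0 r"
  shows "1/2 * (norm (cyclic_sweep H a r x - x))\<^sup>2
    \<le> quad_obj H a x - quad_obj H a (cyclic_sweep H a r x)"
proof -
  define y where "y = cyclic_sweep H a r x"
  define d where "d = y - x"
  have x: "x - y = - d" by (simp add: d_def)
  have "quad_grad H a y \<bullet> d \<le> d \<bullet> (transpose (strict_lower H) *v d)"
    using cyclic_sweep_variational[OF assms, of a x]
    unfolding y_def[symmetric] x d_def[symmetric] by (simp add: inner_commute)
  moreover have "quad_obj H a x = quad_obj H a y - quad_grad H a y \<bullet> d + 1/2 * (d \<bullet> (H *v d))"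
    unfolding quad_obj_expand[OF assms(2), of a x y] x by (simp add: matrix_vector_mult_uminus)
  ultimately show ?thesis
    using quadratic_strict_lower[OF assms(1,2), of d]
    unfolding y_def[symmetric] d_def[symmetric] by linarith
qed

lemma cyclic_sweep_gap_le:
  fixes H :: "real^'n::{finite,linorder}^'n::{finite,linorder}"
    and a r x z :: "real^'n::{finite,linorder}"
  assumes diag: "\<forall>i. H $ i $ i = 1" and sym: "transpose H = H" and z: "z \<in> cbox 0 r"
  defines "y \<equiv> cyclic_sweep H a r x"
  shows "quad_obj H a y - quad_obj H a z
    \<le> (y - z) \<bullet> (transpose (strict_lower H) *v (y - x)) - 1/2 * ((y - z) \<bullet> (H *v (y - z)))"
proof -
  define e where "e = y - z"
  have ze: "z - y = - e" by (simp add: e_def)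
  show ?thesis
    using cyclic_sweep_variational[OF assms(1-3), of a x] quad_obj_expand[OF sym, of a z y]
    unfolding y_def[symmetric] ze e_def[symmetric]
    by (simp add: matrix_vector_mult_uminus inner_commute)
qed

theorem theorem1:
  fixes H M :: "real^'n::{finite,linorder}^'n::{finite,linorder}" and a r :: "real^'n::{finite,linorder}"
  assumes H_psd: "pos_semidef H"
    and H_diag: "\<forall>i. H $ i $ i = 1"
    and r_pos: "\<forall>i. r $ i > 0"
    and M_psd: "pos_semidef M"
    and growth: "\<forall>x\<in>cbox 0 r.
      obj_gap H a r x \<ge>
        1/2 * ((x - closest_point (sol_set H a r) x) \<bullet>
                 (M *v (x - closest_point (sol_set H a r) x)))"
    and HM_pd: "pos_def (H + M)"
  shows "\<forall>\<theta>. 0 < \<theta> \<and> \<theta> < 1 \<longrightarrow>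
    pos_def (H + \<theta> *\<^sub>R M) \<and>
    (\<forall>x\<in>cbox 0 r.
      obj_gap H a r (cyclic_sweep H a r x)
        \<le> 1/2 * A_const H M \<theta> * (norm (cyclic_sweep H a r x - x))\<^sup>2 \<and>
      obj_gap H a r (cyclic_sweep H a r x)
        \<le> A_const H M \<theta> / (1 + A_const H M \<theta>) * obj_gap H a r x)"
proof (intro allI impI conjI ballI; elim conjE)
  fix \<theta> :: real assume th: "0 < \<theta>" "\<theta> < 1"
  let ?K = "H + \<theta> *\<^sub>R M" and ?T = "strict_lower H"
  let ?S = "?T ** matrix_inv ?K ** transpose ?T"
  show pd: "pos_def ?K" using assms th by (intro pos_def_add_scaleR)
  fix x assume x: "x \<in> cbox 0 r"
  define y where "y = cyclic_sweep H a r x"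
  \<comment> \<open>The projection is taken of the sweep's output \<open>y\<close>, so the growth
    condition is applied at \<open>y\<close>, which lies in the box.\<close>
  define z where "z = closest_point (sol_set H a r) y"
  define d where "d = y - x"
  define e where "e = y - z"
  have r: "\<forall>i. r $ i \<ge> 0" using r_pos less_imp_le by blast
  have sym: "transpose H = H" using H_psd by (simp add: pos_semidef_def)
  have zs: "z \<in> sol_set H a r" unfolding z_def by (rule closest_point_in_sol_set[OF r])
  have zb: "z \<in> cbox 0 r" using zs sol_set_subset_box by blast
  have psd: "pos_semidef ?S" by (intro psd_congruence pos_def_inverse pd)
  have A: "A_const H M \<theta> \<ge> 0"
    using lambda_max_nonneg[OF psd] th by (simp add: A_const_def)
  have gap: "obj_gap H a r y = quad_obj H a y - quad_obj H a z"
    unfolding obj_gap_def using min_val_attained(2)[OF r zs] by simp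
  have "obj_gap H a r y \<le> e \<bullet> (transpose ?T *v d) - 1/2 * (e \<bullet> (H *v e))"
    unfolding gap e_def d_def unfolding y_def by (rule cyclic_sweep_gap_le[OF H_diag sym zb])
  moreover have "obj_gap H a r y \<ge> 1/2 * (e \<bullet> (M *v e))"
    using growth cyclic_sweep_in_box[OF r] by (auto simp: e_def z_def y_def)
  \<comment> \<open>Spending a fraction \<open>\<theta>\<close> of the gap on the growth bound turns
    the form of H into that of \<open>?K\<close>, at the price of the factor
    \<open>1 - \<theta>\<close> on the left.\<close>
  then have "\<theta> * obj_gap H a r y \<ge> \<theta> * (1/2 * (e \<bullet> (M *v e)))"
    using th by (intro mult_left_mono) auto
  moreover have "e \<bullet> (?K *v e) = e \<bullet> (H *v e) + \<theta> * (e \<bullet> (M *v e))"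
    by (simp add: matrix_vector_mult_add_rdistrib inner_add_right
        scaleR_matrix_vector_assoc[symmetric])
  ultimately have "(1 - \<theta>) * obj_gap H a r y
      \<le> e \<bullet> (transpose ?T *v d) - 1/2 * (e \<bullet> (?K *v e))"
    by (simp add: algebra_simps)
  also have "\<dots> \<le> 1/2 * ((transpose ?T *v d) \<bullet> (matrix_inv ?K *v (transpose ?T *v d)))"
    by (rule inner_minus_half_quadratic_le[OF pd])
  also have "\<dots> = 1/2 * (d \<bullet> (?S *v d))"
    by (metis dot_lmul_matrix matrix_vector_mul_assoc transpose_matrix_vector)
  also have "\<dots> \<le> 1/2 * (lambda_max ?S * (norm d)\<^sup>2)"
    using lambda_max_bounds(2)[of ?S d] psd by (simp add: pos_semidef_def)
  finally have first: "obj_gap H a r y \<le> 1/2 * A_const H M \<theta> * (norm d)\<^sup>2"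
    using th by (simp add: A_const_def field_simps)
  then show "obj_gap H a r (cyclic_sweep H a r x)
      \<le> 1/2 * A_const H M \<theta> * (norm (cyclic_sweep H a r x - x))\<^sup>2"
    by (simp add: y_def d_def)
  have "1/2 * (norm d)\<^sup>2 \<le> obj_gap H a r x - obj_gap H a r y"
    using cyclic_sweep_descent[OF H_diag sym x] by (simp add: d_def y_def obj_gap_def)
  \<comment> \<open>Nonnegativity of \<open>A_const\<close> is used twice: here to scale the descent
    inequality, and at the end to divide by the positive number
    \<open>1 + A_const H M \<theta>\<close>.\<close>
  then have "A_const H M \<theta> * (1/2 * (norm d)\<^sup>2)
      \<le> A_const H M \<theta> * (obj_gap H a r x - obj_gap H a r y)"
    using A by (rule mult_left_mono)
  with first have "(1 + A_const H M \<theta>) * obj_gap H a r y \<le> A_const H M \<theta> * obj_gap H a r x"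
    by (simp add: algebra_simps)
  then show "obj_gap H a r (cyclic_sweep H a r x)
      \<le> A_const H M \<theta> / (1 + A_const H M \<theta>) * obj_gap H a r x"
    using A by (simp add: y_def[symmetric] field_simps)
qed

end
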